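(* Let $\varepsilon_K>0$ and $\varepsilon_N>0$ satisfy $e^{-\varepsilon_K}+e^{-\varepsilon_N}>1$. Consider the problem $$\min_{\mu_K,\mu_N\in\mathcal P([0,1])}\ \mathrm{KL}(\mu_K\,\|\,\mu_N)\quad\text{subject to}\quad \mathbb E_{\hat x\sim\mu_K}[-\ln\hat x]\le\varepsilon_K,\qquad \mathbb E_{\hat x\sim\mu_N}[-\ln(1-\hat x)]\le\varepsilon_N .$$ Its unique minimizer $(\mu_K^*,\mu_N^* )$ is given by $$\mu_K^*=\delta_{x^*},\qquad \mu_N^*=(1-q^* )\,\delta_0+q^*\,\delta_{x^*},$$ where $x^*=e^{-\varepsilon_K}$ and $q^*=\dfrac{\varepsilon_N}{-\ln(1-x^* )}$.
   Context: $\mathcal P([0,1])$ is the set of Borel probability measures on $[0,1]$, $\delta_x$ is the point mass at $x$, and $\mathrm{KL}$ is the Kullback–Leibler divergence ($+\infty$ when $\mu_K\not\ll\mu_N$; the logarithm base is 2, and does not affect the minimizers). Convention: $-\ln 0=+\infty$. *)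

theory Defs
  imports "HOL-Probability.Probability"
begin

abbreviation borel01 :: "real measure" where
  "borel01 \<equiv> restrict_space borel {0..1}"

definition borel_probs01 :: "real measure set" where
  "borel_probs01 = {M. prob_space M \<and> sets M = sets borel01}"

text \<open>
  \<^term>\<open>- ln x\<close> on the unit interval, with value \<open>\<infinity>\<close> at \<open>0\<close>; the case split is needed because
  the library sets \<^prop>\<open>ln (0::real) = 0\<close>.
\<close>
definition neg_ln :: "real \<Rightarrow> ennreal" where
  "neg_ln x = (if x = 0 then \<infinity> else ennreal (- ln x))"

text \<open>
  \<open>KL M N\<close> is the divergence of \<open>M\<close> from \<open>N\<close>; the library's \<^const>\<open>KL_divergence\<close> takes these
  arguments in the opposite order and is real-valued. For probability measures with
  \<open>M\<close> absolutely continuous with respect to \<open>N\<close>, the negative part of the log-density is always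
  \<open>M\<close>-integrable, so non-integrability means exactly that the defining integral is \<open>+\<infinity>\<close>.
\<close>
definition KL :: "'a measure \<Rightarrow> 'a measure \<Rightarrow> ereal" where
  "KL M N = (if absolutely_continuous N M \<and> integrable M (entropy_density 2 N M)
             then ereal (KL_divergence 2 N M) else \<infinity>)"

text \<open>\<open>mixture q M N\<close> is the measure \<open>(1 - q) M + q N\<close>, for \<open>M\<close> and \<open>N\<close> on the same \<open>\<sigma>\<close>-algebra.\<close>
definition mixture :: "real \<Rightarrow> 'a measure \<Rightarrow> 'a measure \<Rightarrow> 'a measure" where
  "mixture q M N = measure_of (space M) (sets M)
     (\<lambda>A. ennreal (1 - q) * emeasure M A + ennreal q * emeasure N A)"

lemma sets_mixture [simp]: "sets (mixture q M N) = sets M"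
  by (simp add: mixture_def)

lemma space_mixture [simp]: "space (mixture q M N) = space M"
  by (simp add: mixture_def)

lemma emeasure_mixture:
  assumes "sets N = sets M" and A: "A \<in> sets M"
  shows "emeasure (mixture q M N) A = ennreal (1 - q) * emeasure M A + ennreal q * emeasure N A"
proof (rule emeasure_measure_of[OF mixture_def])
  show "sets M \<subseteq> Pow (space M)"
    by (rule sets.space_closed)
  show "A \<in> sets (mixture q M N)"
    using A by simp
  show "positive (sets (mixture q M N))
     (\<lambda>A. ennreal (1 - q) * emeasure M A + ennreal q * emeasure N A)"
    by (simp add: positive_def)
  show "countably_additive (sets (mixture q M N))
     (\<lambda>A. ennreal (1 - q) * emeasure M A + ennreal q * emeasure N A)"
    unfolding countably_additive_def sets_mixture
  proof (intro allI impI)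
    fix F :: "nat \<Rightarrow> 'a set"
    assume F: "range F \<subseteq> sets M" "disjoint_family F"
    have "(\<Sum>i. emeasure M (F i)) = emeasure M (\<Union>i. F i)"
      using F by (rule suminf_emeasure)
    moreover have "(\<Sum>i. emeasure N (F i)) = emeasure N (\<Union>i. F i)"
      using F assms(1) by (intro suminf_emeasure) auto
    ultimately show "(\<Sum>i. ennreal (1 - q) * emeasure M (F i) + ennreal q * emeasure N (F i)) =
      ennreal (1 - q) * emeasure M (\<Union>i. F i) + ennreal q * emeasure N (\<Union>i. F i)"
      by (simp add: suminf_add[symmetric] summableI)
  qed
qed

definition feasible :: "real \<Rightarrow> real \<Rightarrow> real measure \<times> real measure \<Rightarrow> bool" where
  "feasible \<epsilon>K \<epsilon>N = (\<lambda>(\<mu>K, \<mu>N).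
     \<mu>K \<in> borel_probs01 \<and> \<mu>N \<in> borel_probs01 \<and>
     (\<integral>\<^sup>+ x. neg_ln x \<partial>\<mu>K) \<le> ennreal \<epsilon>K \<and>
     (\<integral>\<^sup>+ x. neg_ln (1 - x) \<partial>\<mu>N) \<le> ennreal \<epsilon>N)"

end

theory Submission
  imports Defs
begin

text \<open>
  Write \<open>D = d\<mu>K/d\<mu>N\<close>, \<open>a = exp (- \<epsilon>K)\<close>, \<open>L = - ln (1 - a)\<close>, \<open>q = \<epsilon>N / L\<close> and
  \<open>w x = - ln (1 - x) / L\<close>, so that the second constraint reads \<open>\<integral> w d\<mu>N \<le> q\<close>. Since
  \<open>ln w\<close> is a strictly convex function of \<open>- ln x\<close>, its tangent at \<open>a\<close> gives
  \<open>ln (w x) \<ge> c (ln x - ln a)\<close>; combined with \<open>ln t \<le> t - 1\<close> at \<open>t = w / (q D)\<close> this yields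
  \<open>ln D \<ge> c (ln x - ln a) - ln q + 1 - w / (q D)\<close>, with equality only if \<open>x = a\<close> and
  \<open>D = 1 / q\<close>. Integrating over \<open>\<mu>K\<close> bounds the divergence below by \<open>- ln q\<close>. If it is attained,
  \<open>\<mu>K\<close> is concentrated at \<open>a\<close> and \<open>\<mu>N {a} = q\<close>, which uses up the second
  constraint because \<open>w a = 1\<close>; hence \<open>w\<close> vanishes \<open>\<mu>N\<close>-almost everywhere off \<open>a\<close>.
\<close>

section \<open>The strict tangent inequality\<close>

text \<open>The numerator \<open>exp u * u - (exp u - 1)\<close> of the derivative is positive
  because \<open>exp (- u) > 1 - u\<close>. This monotonicity decides the sign of a derivative on
  either side of \<open>L\<close> in the tangent inequality.\<close>

lemma expm1_divide_strict_mono: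
  fixes s t :: real
  assumes "0 < s" "s < t"
  shows "(exp s - 1) / s < (exp t - 1) / t"
proof (rule DERIV_pos_imp_increasing[OF \<open>s < t\<close>])
  fix u assume u: "s \<le> u" "u \<le> t"
  with assms have "u > 0" by simp
  have "(1 - u) * exp u < exp (- u) * exp u"
    using exp_minus_greater[of u] \<open>u > 0\<close> by (intro mult_strict_right_mono) auto
  then have "exp u * u - (exp u - 1) > 0"
    by (simp add: algebra_simps flip: exp_add)
  then have "(exp u * u - (exp u - 1)) / (u * u) > 0"
    using \<open>u > 0\<close> by simp
  moreover have "((\<lambda>u. (exp u - 1) / u) has_real_derivative (exp u * u - (exp u - 1)) / (u * u)) (at u)"
    using \<open>u > 0\<close> by (auto intro!: derivative_eq_intros)
  ultimately show "\<exists>y. ((\<lambda>u. (exp u - 1) / u) has_real_derivative y) (at u) \<and> 0 < y"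
    by blast
qed

text \<open>
  With \<open>u = - ln (1 - x)\<close> this is the strict tangent inequality at \<open>L\<close> for \<open>ln u\<close>, which is a
  convex function of \<open>- ln x = - ln (1 - exp (- u))\<close>.
\<close>
lemma ln_tangent_less:
  fixes u L :: real
  assumes "0 < u" "0 < L" "u \<noteq> L"
  defines "c \<equiv> (exp L - 1) / L"
  shows "c * (ln (1 - exp (- u)) - ln (1 - exp (- L))) < ln u - ln L"
proof -
  \<comment> \<open>\<open>c\<close> is the slope at \<open>L\<close> of \<open>ln u\<close> as a
    function of \<open>ln (1 - exp (- u))\<close>, so the derivative of \<open>\<phi>\<close>
    vanishes at \<open>L\<close>. It is negative before \<open>L\<close> and positive after it,
    hence \<open>L\<close> is the strict minimum.\<close>
  define \<phi> where "\<phi> = (\<lambda>u. ln u - c * ln (1 - exp (- u)))"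
  have D: "(\<phi> has_real_derivative (1 / (exp t - 1)) * ((exp t - 1) / t - c)) (at t)" if "t > 0" for t
  proof -
    have "(\<phi> has_real_derivative (1 / t - c * (exp (- t) / (1 - exp (- t))))) (at t)"
      unfolding \<phi>_def using that by (auto intro!: derivative_eq_intros simp: field_simps)
    also have "exp (- t) / (1 - exp (- t)) = 1 / (exp t - 1)"
      using that by (simp add: exp_minus field_simps)
    also have "1 / t - c * (1 / (exp t - 1)) = (1 / (exp t - 1)) * ((exp t - 1) / t - c)"
      using that by (simp add: field_simps)
    finally show ?thesis .
  qed
  have cont: "continuous_on {s..t} \<phi>" if "s > 0" for s t
    using that by (intro DERIV_atLeastAtMost_imp_continuous_on exI) (rule D, simp)
  have "\<phi> L < \<phi> u"
  proof (cases "u < L")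
    case True
    show ?thesis
    proof (rule DERIV_neg_imp_decreasing_open[OF True _ cont])
      fix t assume "u < t" "t < L"
      then show "\<exists>y. (\<phi> has_real_derivative y) (at t) \<and> y < 0"
        using D[of t] expm1_divide_strict_mono[of t L] assms
        by (intro exI[of _ "(1 / (exp t - 1)) * ((exp t - 1) / t - c)"])
          (auto simp: c_def intro!: divide_neg_pos)
    qed (use assms in simp)
  next
    case False
    with assms have "L < u" by simp
    show ?thesis
    proof (rule DERIV_pos_imp_increasing_open[OF \<open>L < u\<close> _ cont])
      fix t assume "L < t" "t < u"
      then show "\<exists>y. (\<phi> has_real_derivative y) (at t) \<and> 0 < y"
        using D[of t] expm1_divide_strict_mono[of L t] assms
        by (intro exI[of _ "(1 / (exp t - 1)) * ((exp t - 1) / t - c)"])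
          (auto simp: c_def)
    qed (use assms in simp)
  qed
  then show ?thesis
    by (simp add: \<phi>_def algebra_simps)
qed

section \<open>The constraints as real integrals\<close>

text \<open>A finite integral confines the value \<open>\<infinity>\<close> of
  \<open>neg_ln\<close>, taken where \<open>h\<close> is zero, to a null set. Elsewhere
  \<open>neg_ln\<close> is the real logarithm, so a constraint turns into a bound on a Bochner
  integral.\<close>

lemma neg_ln_integral_bound:
  fixes h :: "'a \<Rightarrow> real"
  assumes [measurable]: "h \<in> borel_measurable M"
    and h: "AE x in M. 0 \<le> h x \<and> h x \<le> 1"
    and le: "(\<integral>\<^sup>+ x. neg_ln (h x) \<partial>M) \<le> ennreal e" and "0 \<le> e"
  shows "AE x in M. 0 < h x" "integrable M (\<lambda>x. - ln (h x))" "(\<integral>x. - ln (h x) \<partial>M) \<le> e"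
proof -
  have "(\<lambda>x. neg_ln (h x)) \<in> borel_measurable M"
    unfolding neg_ln_def by measurable
  moreover have "(\<integral>\<^sup>+ x. neg_ln (h x) \<partial>M) \<noteq> \<infinity>"
    using le by (auto simp: top_unique)
  ultimately have "AE x in M. neg_ln (h x) \<noteq> \<infinity>"
    by (rule nn_integral_PInf_AE)
  with h show pos: "AE x in M. 0 < h x"
    by eventually_elim (auto simp: neg_ln_def split: if_splits)
  have nn: "AE x in M. 0 \<le> - ln (h x)"
    using h pos by eventually_elim auto
  have "(\<integral>\<^sup>+ x. ennreal (- ln (h x)) \<partial>M) = (\<integral>\<^sup>+ x. neg_ln (h x) \<partial>M)"
    using pos by (intro nn_integral_cong_AE) (auto simp: neg_ln_def)
  with le have le': "(\<integral>\<^sup>+ x. ennreal (- ln (h x)) \<partial>M) \<le> ennreal e"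
    by simp
  show int: "integrable M (\<lambda>x. - ln (h x))"
    using nn le_less_trans[OF le' ennreal_less_top] by (intro integrableI_nonneg) auto
  show "(\<integral>x. - ln (h x) \<partial>M) \<le> e"
    using le' nn_integral_eq_integral[OF int nn] \<open>0 \<le> e\<close> by simp
qed

section \<open>Measures concentrated on two points\<close>

text \<open>Almost everywhere \<open>f\<close> coincides with a combination of two indicators, which
  makes the formula valid for arbitrary \<open>f\<close>.\<close>

lemma nn_integral_two_points:
  fixes a b :: 'a
  assumes sing: "{a} \<in> sets M" "{b} \<in> sets M" "a \<noteq> b"
    and ae: "AE x in M. x \<in> {b, a}"
  shows "(\<integral>\<^sup>+ x. f x \<partial>M) = f b * emeasure M {b} + f a * emeasure M {a}"
proof -
  have "(\<integral>\<^sup>+ x. f x \<partial>M) = (\<integral>\<^sup>+ x. f b * indicator {b} x + f a * indicator {a} x \<partial>M)"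
    using ae \<open>a \<noteq> b\<close> by (intro nn_integral_cong_AE) (auto elim!: eventually_mono)
  also have "\<dots> = f b * emeasure M {b} + f a * emeasure M {a}"
    using sing by (simp add: nn_integral_add nn_integral_cmult_indicator)
  finally show ?thesis .
qed

lemma space_borel_probs01:
  assumes "M \<in> borel_probs01"
  shows "space M = {0..1}" "prob_space M" "sets M = sets borel01"
  using assms sets_eq_imp_space_eq[of M borel01]
  by (auto simp: borel_probs01_def space_restrict_space)

lemma singleton_in_borel01: "x \<in> {0..1} \<Longrightarrow> {x} \<in> sets borel01"
  by (auto simp: sets_restrict_space image_iff intro!: bexI[of _ "{x}"])

lemma borel_measurable_probs01:
  assumes "M \<in> borel_probs01" "f \<in> borel_measurable borel"
  shows "f \<in> borel_measurable M"
  unfolding measurable_cong_sets[OF space_borel_probs01(3)[OF assms(1)] refl]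
  by (rule measurable_restrict_space1[OF assms(2)])

lemma return_in_borel_probs01: "x \<in> {0..1} \<Longrightarrow> return borel01 x \<in> borel_probs01"
  by (auto simp: borel_probs01_def intro!: prob_space_return)

text \<open>Total mass one forces mass \<open>1 - q\<close> at \<open>b\<close>; the two-point
  formula applied to indicators then determines the measure of every set.\<close>

lemma eq_mixture_of_returns:
  assumes N: "N \<in> borel_probs01" and ab: "a \<in> {0..1}" "b \<in> {0..1}" "a \<noteq> b"
    and ae: "AE x in N. x \<in> {b, a}" and q: "emeasure N {a} = ennreal q" "0 \<le> q"
  shows "N = mixture q (return borel01 b) (return borel01 a)"
proof (rule measure_eqI)
  note sets = space_borel_probs01(3)[OF N]
  note sing = singleton_in_borel01[OF ab(1), folded sets] singleton_in_borel01[OF ab(2), folded sets]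
  interpret N: prob_space N using space_borel_probs01(2)[OF N] .
  have int: "(\<integral>\<^sup>+ x. f x \<partial>N) = f b * emeasure N {b} + f a * ennreal q" for f
    using nn_integral_two_points[OF sing ab(3) ae, of f] q by simp
  have "1 = emeasure N {b} + ennreal q"
    using int[of "\<lambda>_. 1"] N.emeasure_space_1 by simp
  then have b: "emeasure N {b} = ennreal (1 - q)"
    by (metis \<open>0 \<le> q\<close> ennreal_1 ennreal_add_diff_cancel_right ennreal_minus ennreal_neq_top)
  show "sets N = sets (mixture q (return borel01 b) (return borel01 a))"
    using sets by simp
  fix A assume A: "A \<in> sets N"
  then have "emeasure N A = indicator A b * ennreal (1 - q) + indicator A a * ennreal q"
    using int[of "indicator A"] b by simp
  with A sets show "emeasure N A = emeasure (mixture q (return borel01 b) (return borel01 a)) A"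
    by (simp add: emeasure_mixture mult.commute)
qed

lemma mixture_of_returns:
  assumes ab: "a \<in> {0..1}" "b \<in> {0..1}" "a \<noteq> b" and q: "0 \<le> q" "q \<le> 1"
  defines "N \<equiv> mixture q (return borel01 b) (return borel01 a)"
  shows "N \<in> borel_probs01" "emeasure N {a} = ennreal q" "emeasure N {b} = ennreal (1 - q)"
    "AE x in N. x \<in> {b, a}"
proof -
  have sets: "sets N = sets borel01"
    by (simp add: N_def)
  have em: "emeasure N A = ennreal (1 - q) * indicator A b + ennreal q * indicator A a"
    if "A \<in> sets borel01" for A
    using that by (simp add: N_def emeasure_mixture)
  have sp: "space N = {0..1}"
    by (simp add: N_def space_restrict_space)
  have "emeasure N (space N) = ennreal (1 - q) + ennreal q"
    using ab by (subst em) (auto simp: sp space_restrict_space sets_restrict_space)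
  \<comment> \<open>\<open>ennreal\<close> truncates negative numbers to 0; the weights add up to
    one because \<open>0 \<le> q\<close> and \<open>q \<le> 1\<close>.\<close>
  also have "\<dots> = 1"
    using q by (simp flip: ennreal_plus)
  finally show "N \<in> borel_probs01"
    by (auto simp: borel_probs01_def sets intro!: prob_spaceI)
  note sing = singleton_in_borel01[OF ab(1)] singleton_in_borel01[OF ab(2)]
  show "emeasure N {a} = ennreal q" "emeasure N {b} = ennreal (1 - q)"
    using em sing ab by simp_all
  have "{a, b} \<in> sets borel01"
    using sets.Un[OF sing] by (simp add: insert_commute)
  then have S: "space N - {b, a} \<in> sets borel01"
    using sets.Diff[OF sets.top[of N]] sets by (simp add: insert_commute)
  show "AE x in N. x \<in> {b, a}"
    by (rule AE_I[of _ _ "space N - {b, a}"]) (use em[OF S] S sets in auto)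
qed

section \<open>The lower bound on the divergence and its equality case\<close>

text \<open>Optimality and uniqueness at once: since a pair doing no worse than the candidate must
  be the candidate, no pair can do strictly better.\<close>

lemma feasible_KL_le_imp_eq:
  fixes K N :: "real measure" and a q :: real
  assumes feas: "feasible (- ln a) eN (K, N)"
    and a: "0 < a" "a < 1" and eN: "0 < eN" "q = eN / (- ln (1 - a))"
    and KL: "KL K N \<le> ereal (log 2 (1 / q))"
  shows "K = return borel01 a" "N = mixture q (return borel01 0) (return borel01 a)"
proof -
  define L where "L = - ln (1 - a)"
  define c where "c = (exp L - 1) / L"
  define w where "w x = - ln (1 - x) / L" for x
  have L: "L > 0" and wa: "w a = 1"
    using a by (auto simp: L_def w_def)
  have q: "q > 0"
    unfolding eN(2) L_def[symmetric] using eN(1) L by (rule divide_pos_pos)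
  have Kb: "K \<in> borel_probs01" and Nb: "N \<in> borel_probs01"
    and cK: "(\<integral>\<^sup>+ x. neg_ln x \<partial>K) \<le> ennreal (- ln a)"
    and cN: "(\<integral>\<^sup>+ x. neg_ln (1 - x) \<partial>N) \<le> ennreal eN"
    using feas by (auto simp: feasible_def)
  note sets = space_borel_probs01(3)[OF Kb] space_borel_probs01(3)[OF Nb]
  note space = space_borel_probs01(1)[OF Kb] space_borel_probs01(1)[OF Nb]
  note meas = borel_measurable_probs01[OF Kb] borel_measurable_probs01[OF Nb]
  interpret K: prob_space K using space_borel_probs01(2)[OF Kb] .
  interpret N: prob_space N using space_borel_probs01(2)[OF Nb] .
  have KN: "sets K = sets N" by (simp add: sets)
  have wmeas [measurable]: "w \<in> borel_measurable N" "w \<in> borel_measurable K"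
    by (intro meas; simp add: w_def[abs_def])+

  have ac: "absolutely_continuous N K" and int: "integrable K (entropy_density 2 N K)"
    and KLle: "(\<integral>x. entropy_density 2 N K x \<partial>K) \<le> log 2 (1 / q)"
    using KL by (auto simp: KL_def KL_divergence_def split: if_splits)
  obtain D where [measurable]: "D \<in> borel_measurable N"
    and D: "AE x in N. RN_deriv N K x = ennreal (D x)" "AE x in K. 0 < D x" "\<And>x. 0 \<le> D x"
    using N.real_RN_deriv[OF K.finite_measure ac KN] by blast
  have [measurable]: "D \<in> borel_measurable K"
    unfolding measurable_cong_sets[OF KN refl] by fact
  have Kdens: "density N (\<lambda>x. ennreal (D x)) = K"
  proof -
    have "density N (\<lambda>x. ennreal (D x)) = density N (RN_deriv N K)"
      using D(1) by (intro density_cong) auto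
    then show ?thesis by (simp add: N.density_RN_deriv[OF ac KN])
  qed
  note AEK = absolutely_continuous_AE[OF KN ac]
  have ed: "AE x in K. entropy_density 2 N K x = ln (D x) / ln 2"
    using AEK[OF D(1)] by eventually_elim (simp add: entropy_density_def log_def D(3))
  have edm: "entropy_density 2 N K \<in> borel_measurable K"
    using int by simp
  have lnD: "integrable K (\<lambda>x. ln (D x))"
  proof -
    have "integrable K (\<lambda>x. ln (D x) / ln 2)"
      using int ed edm by (subst (asm) integrable_cong_AE) auto
    then have "integrable K (\<lambda>x. ln (D x) / ln 2 * ln 2)"
      by (rule integrable_mult_left)
    then show ?thesis by simp
  qed
  have lnD_le: "(\<integral>x. ln (D x) \<partial>K) \<le> - ln q"
  proof -
    have "(\<integral>x. entropy_density 2 N K x \<partial>K) = (\<integral>x. ln (D x) / ln 2 \<partial>K)"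
      using ed edm by (intro integral_cong_AE) auto
    also have "\<dots> = (\<integral>x. ln (D x) \<partial>K) / ln 2"
      by (rule integral_divide_zero)
    finally have "(\<integral>x. ln (D x) \<partial>K) / ln 2 \<le> - ln q / ln 2"
      using KLle q by (simp add: log_def ln_div)
    then show ?thesis
      by (subst (asm) divide_le_cancel) auto
  qed

  have "AE x in K. 0 \<le> x \<and> x \<le> 1"
    using space by (intro AE_I2) auto
  moreover have "(\<lambda>x. x) \<in> borel_measurable K"
    by (rule meas) simp
  ultimately have posK: "AE x in K. 0 < x"
    and lnK: "integrable K (\<lambda>x. - ln x)" "(\<integral>x. - ln x \<partial>K) \<le> - ln a"
    using neg_ln_integral_bound[of "\<lambda>x. x" K "- ln a"] cK a by auto
  have "AE x in N. 0 \<le> 1 - x \<and> 1 - x \<le> 1"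
    using space by (intro AE_I2) auto
  moreover have "(\<lambda>x. 1 - x) \<in> borel_measurable N"
    by (rule meas) simp
  ultimately have ltN: "AE x in N. x < 1"
    and lnN: "integrable N (\<lambda>x. - ln (1 - x))" "(\<integral>x. - ln (1 - x) \<partial>N) \<le> eN"
    using neg_ln_integral_bound[of "\<lambda>x. 1 - x" N eN] cN eN(1) by auto
  \<comment> \<open>The second constraint speaks of \<open>N\<close>; absolute continuity carries
    its consequence over to \<open>K\<close>.\<close>
  have ltK: "AE x in K. x < 1" by (rule AEK[OF ltN])
  have w_nn: "AE x in N. 0 \<le> w x"
    using ltN AE_space by eventually_elim (use L space in \<open>auto simp: w_def divide_le_0_iff\<close>)
  have wN: "integrable N w" "(\<integral>x. w x \<partial>N) \<le> q"
  proof -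
    show "integrable N w"
      using integrable_divide_zero[of L N "\<lambda>x. - ln (1 - x)"] lnN(1) by (simp add: w_def[abs_def])
    have "(\<integral>x. w x \<partial>N) = (\<integral>x. - ln (1 - x) \<partial>N) / L"
      unfolding w_def by (rule integral_divide_zero)
    also have "\<dots> \<le> eN / L"
      using lnN(2) L by (intro divide_right_mono) auto
    finally show "(\<integral>x. w x \<partial>N) \<le> q" by (simp add: eN L_def)
  qed
  \<comment> \<open>The integral is only bounded: \<open>D\<close> may vanish on a set of positive \<open>N\<close>-measure.\<close>
  have wD: "integrable K (\<lambda>x. w x / D x)" "(\<integral>x. w x / D x \<partial>K) \<le> q"
  proof -
    \<comment> \<open>Division by zero gives 0, so the product is \<open>w x\<close> where
      \<open>D x\<close> is nonzero and 0 elsewhere.\<close>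
    have le: "AE x in N. norm (D x * (w x / D x)) \<le> norm (w x)"
      by (auto simp: divide_simps)
    then have int': "integrable N (\<lambda>x. D x * (w x / D x))"
      by (intro Bochner_Integration.integrable_bound[OF wN(1)]) measurable
    then have "integrable (density N (\<lambda>x. ennreal (D x))) (\<lambda>x. w x / D x)"
      using D(3) by (subst integrable_density) auto
    then show "integrable K (\<lambda>x. w x / D x)" by (simp add: Kdens)
    have "(\<integral>x. w x / D x \<partial>K) = (\<integral>x. D x * (w x / D x) \<partial>N)"
      unfolding Kdens[symmetric] using D(3) by (subst integral_density) auto
    also have "\<dots> \<le> (\<integral>x. w x \<partial>N)"
      using w_nn int' wN(1) by (intro integral_mono_AE) auto
    finally show "(\<integral>x. w x / D x \<partial>K) \<le> q" using wN(2) by simp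
  qed

  \<comment> \<open>The gap between the two sides of the pointwise lower bound for
    \<open>ln D\<close>, arranged so that each summand can be integrated separately.\<close>
  define g where "g x = ln (D x) + c * (- ln x) + c * ln a + ln q - 1 + w x / D x / q" for x
  have g_pos: "0 \<le> g x \<and> (g x = 0 \<longrightarrow> x = a \<and> D x = 1 / q)"
    if x: "0 < x" "x < 1" "0 < D x" for x
  proof -
    define u where "u = - ln (1 - x)"
    have "u > 0" "w x = u / L" and eu: "1 - exp (- u) = x" "1 - exp (- L) = a"
      using x a by (auto simp: u_def w_def L_def)
    then have wx: "w x > 0" and lnw: "ln (w x) = ln u - ln L"
      using L by (auto simp: ln_div)
    define t where "t = w x / D x / q"
    have t: "t > 0" and lnt: "ln t = ln (w x) - ln (D x) - ln q"
      using wx x q by (auto simp: t_def ln_div ln_mult)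
    \<comment> \<open>The gap splits into the error of the tangent inequality and the error of
      \<open>ln t \<le> t - 1\<close>. The first is zero at \<open>a\<close> and strictly positive
      elsewhere.\<close>
    have g_eq: "g x = (ln (w x) - c * (ln x - ln a)) + (t - 1 - ln t)"
      unfolding lnt by (simp add: g_def t_def algebra_simps)
    have 1: "t - 1 - ln t \<ge> 0" "t - 1 - ln t = 0 \<Longrightarrow> t = 1"
      using ln_le_minus_one[OF t] ln_eq_minus_one[OF t] by auto
    show ?thesis
    proof (cases "x = a")
      case True
      have "g x = t - 1 - ln t"
        unfolding g_eq by (simp add: True wa)
      moreover have "D x = 1 / q" if "t = 1"
        using that x q by (simp add: t_def True wa field_simps)
      ultimately show ?thesis using 1 True by simp
    next
      case False
      then have "u \<noteq> L" using eu by auto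
      from ln_tangent_less[OF \<open>u > 0\<close> L this]
      have "c * (ln x - ln a) < ln (w x)"
        by (simp add: eu lnw c_def)
      with 1(1) show ?thesis by (simp add: g_eq)
    qed
  qed
  have g_nn: "AE x in K. 0 \<le> g x"
    using posK ltK D(2) by eventually_elim (use g_pos in auto)
  have g_int: "integrable K g"
    unfolding g_def[abs_def]
    by (intro Bochner_Integration.integrable_add Bochner_Integration.integrable_diff
        integrable_mult_right integrable_divide_zero lnD lnK wD K.integrable_const)
  have "(\<integral>x. g x \<partial>K) = (\<integral>x. ln (D x) \<partial>K) + c * (\<integral>x. - ln x \<partial>K)
    + c * ln a + ln q - 1 + (\<integral>x. w x / D x \<partial>K) / q"
    unfolding g_def using lnD lnK wD
    by (simp add: K.prob_space del: divide_divide_eq_left)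
  \<comment> \<open>The bounds used are the assumed one on the divergence, the constraint on
    \<open>K\<close> weighted by \<open>c \<ge> 0\<close>, and the constraint on \<open>N\<close>
    through \<open>w / D\<close>.\<close>
  also have "\<dots> \<le> - ln q + c * (- ln a) + c * ln a + ln q - 1 + q / q"
    using lnD_le lnK(2) wD(2) q L
    by (intro add_mono diff_mono mult_left_mono divide_right_mono order_refl) (auto simp: c_def)
  also have "\<dots> = 0"
    using q by simp
  finally have "(\<integral>x. g x \<partial>K) = 0"
    using integral_nonneg_AE[OF g_nn] by simp
  then have "AE x in K. g x = 0"
    using integral_nonneg_eq_0_iff_AE[OF g_int g_nn] by simp
  with posK ltK D(2) have xD: "AE x in K. x = a \<and> D x = 1 / q"
    by eventually_elim (use g_pos in auto)
  then have "AE x in K. x = a" by eventually_elim simp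
  note Kret = K.AE_eq_constD(1)[OF this]
  then show Keq: "K = return borel01 a"
    using return_cong[OF sets(1)] by simp

  have aI: "a \<in> space K" using a space by simp
  \<comment> \<open>Under a point mass an almost everywhere statement holds at the point itself,
    which fixes the value of \<open>D\<close> there.\<close>
  have "AE x in return K a. D x = 1 / q"
    using xD unfolding Kret[symmetric] by eventually_elim simp
  then have Da: "D a = 1 / q"
    using aI by (subst (asm) AE_return) auto
  have a_sets: "{a} \<in> sets N"
    using singleton_in_borel01[of a] a sets by simp
  have "1 = emeasure K {a}"
    using a_sets sets by (simp add: Keq)
  also have "\<dots> = (\<integral>\<^sup>+ x. ennreal (D x) * indicator {a} x \<partial>N)"
    using a_sets by (subst Kdens[symmetric]) (simp add: emeasure_density)
  also have "\<dots> = (\<integral>\<^sup>+ x. ennreal (1 / q) * indicator {a} x \<partial>N)"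
    by (intro nn_integral_cong) (auto simp: Da indicator_def)
  also have "\<dots> = ennreal (1 / q * measure N {a})"
    using a_sets q
    by (subst ennreal_mult) (simp_all add: nn_integral_cmult_indicator N.emeasure_eq_measure)
  finally have Na: "measure N {a} = q"
    using q by (simp add: field_simps)

  have "AE x in N. w x * indicator (- {a}) x = 0"
  proof -
    \<comment> \<open>\<open>v\<close> is \<open>w\<close> with its value at \<open>a\<close>
      removed. As \<open>w a = 1\<close> and \<open>{a}\<close> has mass \<open>q\<close>, the atom
      already uses the whole bound \<open>q\<close> on the integral of \<open>w\<close>.\<close>
    define v where "v x = w x - indicator {a} x" for x
    have v: "v x = w x * indicator (- {a}) x" for x
      by (auto simp: v_def wa indicator_def)
    have v_nn: "AE x in N. 0 \<le> v x"
      using w_nn by eventually_elim (simp add: v)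
    have v_int: "integrable N v"
      unfolding v_def[abs_def] using a_sets wN(1) by (auto simp: N.emeasure_eq_measure)
    have "(\<integral>x. v x \<partial>N) = (\<integral>x. w x \<partial>N) - q"
      unfolding v_def using a_sets wN(1) Na by (simp add: N.emeasure_eq_measure)
    then have "(\<integral>x. v x \<partial>N) = 0"
      using wN(2) integral_nonneg_AE[OF v_nn] by simp
    then show ?thesis
      using integral_nonneg_eq_0_iff_AE[OF v_int v_nn] by (simp add: v)
  qed
  \<comment> \<open>Off \<open>a\<close>, \<open>w x = 0\<close> means
    \<open>ln (1 - x) = 0\<close>. The bound \<open>x < 1\<close> excludes the spurious solution
    \<open>x = 1\<close> due to \<open>ln 0 = 0\<close>, leaving \<open>x = 0\<close>.\<close>
  then have "AE x in N. x \<in> {0, a}"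
    using ltN AE_space
    by eventually_elim (use L space in \<open>auto simp: w_def indicator_def split: if_splits\<close>)
  then show "N = mixture q (return borel01 0) (return borel01 a)"
    using a q Na by (intro eq_mixture_of_returns[OF Nb]) (auto simp: N.emeasure_eq_measure)
qed

section \<open>Feasibility and value of the candidate\<close>

text \<open>Both constraints hold with equality: the atom at 0 costs nothing in the second one, and
  \<open>q\<close> is chosen so that the atom at \<open>a\<close> costs exactly
  \<open>eN\<close>.\<close>

lemma optimum_feasible:
  fixes a q :: real
  assumes a: "0 < a" "a < 1" and eN: "0 < eN" "q = eN / (- ln (1 - a))" and "q \<le> 1"
  shows "feasible (- ln a) eN (return borel01 a, mixture q (return borel01 0) (return borel01 a))"
proof -
  define N where "N = mixture q (return borel01 0) (return borel01 a)"
  have L: "- ln (1 - a) > 0" using a by simp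
  have q: "0 < q" unfolding eN(2) using eN(1) L by (rule divide_pos_pos)
  have ab: "a \<in> {0..1}" "(0::real) \<in> {0..1}" "a \<noteq> 0" using a by auto
  note N = mixture_of_returns[OF ab less_imp_le[OF q] \<open>q \<le> 1\<close>, folded N_def]
  note sets = space_borel_probs01(3)[OF N(1)]
  have "(\<integral>\<^sup>+ x. neg_ln x \<partial>return borel01 a) = neg_ln a"
    using a by (intro nn_integral_return measurable_restrict_space1)
      (auto simp: space_restrict_space neg_ln_def[abs_def])
  moreover have "(\<integral>\<^sup>+ x. neg_ln (1 - x) \<partial>N) = ennreal eN"
  proof -
    have "(\<integral>\<^sup>+ x. neg_ln (1 - x) \<partial>N) = neg_ln (1 - a) * ennreal q"
      using N singleton_in_borel01 ab
      by (subst nn_integral_two_points[of a _ 0]) (auto simp: sets neg_ln_def)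
    also have "\<dots> = ennreal (- ln (1 - a) * q)"
      using a L q ennreal_mult[of "- ln (1 - a)" q] by (simp add: neg_ln_def)
    also have "- ln (1 - a) * q = eN"
      using L eN by simp
    finally show ?thesis .
  qed
  ultimately show ?thesis
    using a N(1) return_in_borel_probs01[OF ab(1)]
    by (auto simp: feasible_def neg_ln_def N_def)
qed

text \<open>As \<open>{a}\<close> has positive mass under \<open>N\<close>, no \<open>N\<close>-null
  set contains \<open>a\<close>, and the density of the point mass is determined at \<open>a\<close>
  as \<open>1 / q\<close>. The divergence is the logarithm of this single value.\<close>

lemma KL_return:
  assumes N: "N \<in> borel_probs01" and a: "a \<in> {0..1}" and q: "emeasure N {a} = ennreal q" "0 < q"
  shows "KL (return borel01 a) N = ereal (log 2 (1 / q))"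
proof -
  define K where "K = return borel01 a"
  note sets = space_borel_probs01(3)[OF N]
  interpret N: prob_space N using space_borel_probs01(2)[OF N] .
  have KN: "sets K = sets N" by (simp add: K_def sets)
  have aK: "a \<in> space borel01" using a by (simp add: space_restrict_space)
  interpret K: prob_space K unfolding K_def using aK by (rule prob_space_return)
  have a_sets: "{a} \<in> sets N"
    using singleton_in_borel01[OF a] sets by simp
  have ac: "absolutely_continuous N K"
    unfolding absolutely_continuous_def
  proof
    fix A assume A: "A \<in> null_sets N"
    then have "a \<notin> A"
      using q emeasure_mono[of "{a}" A N] by (auto simp: null_sets_def)
    with A show "A \<in> null_sets K"
      using sets by (auto simp: null_sets_def K_def)
  qed
  have "1 = emeasure (density N (RN_deriv N K)) {a}"
    using a_sets sets by (subst N.density_RN_deriv[OF ac KN]) (simp add: K_def)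
  also have "\<dots> = (\<integral>\<^sup>+ x. RN_deriv N K x * indicator {a} x \<partial>N)"
    using a_sets by (intro emeasure_density) auto
  also have "\<dots> = (\<integral>\<^sup>+ x. RN_deriv N K a * indicator {a} x \<partial>N)"
    by (intro nn_integral_cong) (auto simp: indicator_def)
  also have "\<dots> = RN_deriv N K a * ennreal q"
    using a_sets q by (simp add: nn_integral_cmult_indicator)
  finally have "enn2real (RN_deriv N K a * ennreal q) = 1"
    by simp
  then have RN: "enn2real (RN_deriv N K a) = 1 / q"
    using q by (simp add: enn2real_mult field_simps)
  have ed: "entropy_density 2 N K \<in> borel_measurable borel01"
    unfolding measurable_cong_sets[OF sets[symmetric] refl] by (rule measurable_entropy_density)
  have val: "entropy_density 2 N K a = log 2 (1 / q)"
    by (simp add: entropy_density_def RN)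
  have "AE x in K. entropy_density 2 N K x = entropy_density 2 N K a"
    using ed aK unfolding K_def by (subst AE_return) auto
  then have "integrable K (entropy_density 2 N K)"
    by (intro integrable_cong_AE[THEN iffD2, OF _ _ _ K.integrable_const])
      (use ed in \<open>auto simp: K_def\<close>)
  moreover have "KL_divergence 2 N K = log 2 (1 / q)"
    unfolding KL_divergence_def val[symmetric] using integral_return[OF aK ed] by (simp add: K_def)
  ultimately show ?thesis
    using ac by (simp add: KL_def K_def)
qed

theorem theorem4p1:
  fixes \<epsilon>K \<epsilon>N xs qs :: real
  assumes "\<epsilon>K > 0" and "\<epsilon>N > 0"
    and "exp (- \<epsilon>K) + exp (- \<epsilon>N) > 1"
    and "xs = exp (- \<epsilon>K)"
    and "qs = \<epsilon>N / (- ln (1 - xs))"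
  shows "{p. is_arg_min (\<lambda>(\<mu>K, \<mu>N). KL \<mu>K \<mu>N) (feasible \<epsilon>K \<epsilon>N) p} =
    {(return borel01 xs, mixture qs (return borel01 0) (return borel01 xs))}"
proof -
  let ?opt = "(return borel01 xs, mixture qs (return borel01 0) (return borel01 xs))"
  let ?KL = "\<lambda>(\<mu>K, \<mu>N). KL \<mu>K \<mu>N"
  have xs: "0 < xs" "xs < 1" and eK: "\<epsilon>K = - ln xs"
    using assms by auto
  \<comment> \<open>The hypothesis on the exponentials says
    \<open>1 - xs < exp (- \<epsilon>N)\<close>; it is what keeps the weight \<open>qs\<close> below
    one.\<close>
  have "ln (1 - xs) < ln (exp (- \<epsilon>N))"
    using xs assms by (subst ln_less_cancel_iff) auto
  then have L: "\<epsilon>N < - ln (1 - xs)" by simp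
  have "0 < - ln (1 - xs)" using L assms(2) by linarith
  then have qs: "0 < qs" "qs \<le> 1"
    using L assms(2) by (simp_all only: assms(5) divide_pos_pos divide_le_eq_1_pos less_imp_le)
  have feas: "feasible \<epsilon>K \<epsilon>N ?opt"
    unfolding eK by (rule optimum_feasible[OF xs assms(2,5) qs(2)])
  have "emeasure (snd ?opt) {xs} = ennreal qs"
    using mixture_of_returns(2)[of xs 0 qs] xs qs by simp
  then have KL: "?KL ?opt = ereal (log 2 (1 / qs))"
    using feas xs qs by (auto simp: feasible_def intro!: KL_return)
  have uniq: "p = ?opt" if p: "feasible \<epsilon>K \<epsilon>N p" "?KL p \<le> ?KL ?opt" for p
  proof (cases p)
    case (Pair K N)
    have "feasible (- ln xs) \<epsilon>N (K, N)" "KL K N \<le> ereal (log 2 (1 / qs))"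
      using p KL unfolding Pair eK by simp_all
    from feasible_KL_le_imp_eq[OF this(1) xs assms(2,5) this(2)] show ?thesis
      by (simp add: Pair)
  qed
  show ?thesis
  proof (intro equalityI subsetI singletonI CollectI; (drule CollectD | drule singletonD)?)
    fix p assume "is_arg_min ?KL (feasible \<epsilon>K \<epsilon>N) p"
    then have "feasible \<epsilon>K \<epsilon>N p" "\<not> ?KL ?opt < ?KL p"
      using feas unfolding is_arg_min_def by blast+
    then show "p \<in> {?opt}"
      using uniq[of p] not_less by blast
  next
    fix p assume "p = ?opt"
    \<comment> \<open>A strictly better \<open>p'\<close> would equal \<open>?opt\<close> by
      \<open>uniq\<close>, contradicting irreflexivity.\<close>
    moreover have "\<not> ?KL p' < ?KL ?opt" if "feasible \<epsilon>K \<epsilon>N p'" for p'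
      using uniq[OF that less_imp_le] less_irrefl by metis
    ultimately show "is_arg_min ?KL (feasible \<epsilon>K \<epsilon>N) p"
      using feas unfolding is_arg_min_def by blast
  qed
qed

end
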